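(* Let $d$ be a positive integer and $K \subset \mathbb{R}^d$ be compact. Suppose that for any $2d$ points in $K$ there exists an axis-parallel box of volume $1$ such that every point in the box sees each of the given $2d$ points. Then there exists an axis-parallel box of volume $1$ such that every point in the box sees all of $K$.
   Context: For $K \subset \mathbb{R}^d$ and $x,y \in K$, $x$ sees $y$ if the closed segment $[x,y]$ is contained in $K$ (in particular a point that sees a point of $K$ lies in $K$). *)

theory Defs
  imports "HOL-Analysis.Analysis"
begin

text \<open>Both endpoints belong to the segment, so \<open>sees K x y\<close> entails that \<open>x\<close> and \<open>y\<close> lie in \<open>K\<close>.\<close>

definition sees :: "'a::real_vector set \<Rightarrow> 'a \<Rightarrow> 'a \<Rightarrow> bool" where
  "sees K x y \<longleftrightarrow> closed_segment x y \<subseteq> K"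

text \<open>Boxes are closed. The coordinate axes are those of \<open>real ^ 'd\<close>, whose order is componentwise.\<close>

definition axis_parallel_box :: "(real ^ 'd) set \<Rightarrow> bool" where
  "axis_parallel_box B \<longleftrightarrow> (\<exists>a b. a \<le> b \<and> B = cbox a b)"

end

theory Submission
  imports Defs
begin

text \<open>
  A point lying in the convex hull of every visibility region \<open>{x. sees K x y}\<close> sees all of the
  compact set \<open>K\<close> (Krasnoselskii's argument), so it suffices to find a box of volume \<open>1\<close> in the
  intersection of these hulls. Identify boxes with pairs \<open>(a, b)\<close> in \<open>\<real>\<^sup>2\<^sup>d\<close>. By log-concavity of
  the product, the boxes of volume at least \<open>1\<close> contained in a convex set form a convex set of
  pairs. Forgetting one coordinate of \<open>b\<close> projects these sets into dimension \<open>2d - 1\<close>, where Helly's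
  theorem has Helly number \<open>2d\<close>; nothing is lost, because boxes that agree in all the other
  coordinates are nested. Compactness handles the infinite family, and shrinking one side
  of the box makes its volume exactly \<open>1\<close>.
\<close>

section \<open>Helly's theorem in a subspace\<close>

lemma Helly_subspace:
  fixes C :: "'i \<Rightarrow> 'a::euclidean_space set"
  assumes "finite I" and V: "subspace V"
    and convex: "\<And>i. i \<in> I \<Longrightarrow> convex (C i)" and sub: "\<And>i. i \<in> I \<Longrightarrow> C i \<subseteq> V"
    and meet: "\<And>J. J \<subseteq> I \<Longrightarrow> card J \<le> dim V + 1 \<Longrightarrow> (\<Inter>j\<in>J. C j) \<noteq> {}"
  shows "(\<Inter>i\<in>I. C i) \<noteq> {}"
  using assms(1,3-5)
proof (induction "card I" arbitrary: I rule: less_induct)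
  case less
  show ?case
  proof (cases "card I \<le> dim V + 1")
    case True
    show ?thesis by (rule less.prems(4)[OF subset_refl True])
  next
    case False
    have "(\<Inter>j\<in>I - {i}. C j) \<noteq> {}" if "i \<in> I" for i
    proof (rule less.hyps)
      show "card (I - {i}) < card I"
        using that \<open>finite I\<close> by (meson card_Diff1_less)
      show "(\<Inter>j\<in>J. C j) \<noteq> {}" if "J \<subseteq> I - {i}" "card J \<le> dim V + 1" for J
        using that by (intro less.prems(4)) auto
    qed (use less.prems in auto)
    then have "\<forall>i\<in>I. \<exists>x. x \<in> (\<Inter>j\<in>I - {i}. C j)"
      unfolding ex_in_conv by (rule ballI)
    from bchoice[OF this] obtain X where "\<forall>i\<in>I. X i \<in> (\<Inter>j\<in>I - {i}. C j)" ..
    then have X: "X i \<in> C j" if "i \<in> I" "j \<in> I" "j \<noteq> i" for i j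
      using that by simp
    show ?thesis
    proof (cases "inj_on X I")
      case False
      \<comment> \<open>Two equal points settle this case: \<open>X i\<close> lies in every set but
        possibly \<open>C i\<close>, and as \<open>X k\<close> it lies in \<open>C i\<close> as
        well.\<close>
      then obtain i k where "i \<in> I" "k \<in> I" "i \<noteq> k" "X i = X k"
        by (auto simp: inj_on_def)
      then have "X i \<in> C j" if "j \<in> I" for j
        using X that by metis
      then show ?thesis by blast
    next
      case True
      have "X ` I \<subseteq> V"
      proof
        fix x assume "x \<in> X ` I"
        then obtain i where i: "i \<in> I" "x = X i" by blast
        have "card I > 1" using False by simp
        then obtain j where "j \<in> I" "j \<noteq> i"
          by (metis One_nat_def card_le_Suc0_iff_eq i(1) less.prems(1) not_less)
        then show "x \<in> V" using X i less.prems(3) by blast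
      qed
      then have "dim (X ` I) \<le> dim V"
        by (rule dim_subset)
      moreover have "card (X ` I) = card I"
        using True by (rule card_image)
      ultimately have "affine_dependent (X ` I)"
        using False less.prems(1) by (intro affine_dependent_biggerset_general) auto
      then obtain M P where MP: "M \<subseteq> X ` I" "P \<subseteq> X ` I" "M \<inter> P = {}"
        and "convex hull M \<inter> convex hull P \<noteq> {}"
        by (rule Radon)
      then obtain z where z: "z \<in> convex hull M" "z \<in> convex hull P"
        by blast
      \<comment> \<open>Since \<open>M\<close> and \<open>P\<close> are disjoint, \<open>X i\<close>
        is missing from at least one of them. All points of that part lie in \<open>C i\<close>,
        hence so does its hull, which contains \<open>z\<close>.\<close>
      have avoid: "convex hull N \<subseteq> C i" if "i \<in> I" "N \<subseteq> X ` I" "X i \<notin> N" for i N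
        using that X less.prems(2) by (intro hull_minimal) auto
      have "z \<in> C i" if "i \<in> I" for i
        using avoid[OF that] MP z by blast
      then show ?thesis by blast
    qed
  qed
qed

section \<open>Boxes of volume at least one inside a convex set\<close>

text \<open>Requiring volume at least 1, not exactly 1, is what makes this set of corner pairs
  convex.\<close>

definition big_boxes :: "(real ^ 'd) set \<Rightarrow> ((real ^ 'd) \<times> (real ^ 'd)) set" where
  "big_boxes C = {(a, b). a \<le> b \<and> 1 \<le> (\<Prod>i\<in>UNIV. b $ i - a $ i) \<and> cbox a b \<subseteq> C}"

text \<open>For a fixed parameter \<open>u\<close> the point is linear in the pair
  \<open>(a, b)\<close>. Containment of a box in a set thus becomes a family of conditions indexed
  by the unit cube, each suited to convexity and closedness arguments.\<close>

lemma cbox_eq_image_unit_cbox: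
  fixes a b :: "real ^ 'd"
  assumes "a \<le> b"
  shows "cbox a b = (\<lambda>u. \<chi> i. a $ i + u $ i * (b $ i - a $ i)) ` cbox 0 1"
proof (intro equalityI subsetI)
  fix x assume x: "x \<in> cbox a b"
  define u :: "real ^ 'd" where "u = (\<chi> i. (x $ i - a $ i) / (b $ i - a $ i))"
  have "0 \<le> u $ i \<and> u $ i \<le> 1 \<and> x $ i = a $ i + u $ i * (b $ i - a $ i)" for i
  proof (cases "a $ i = b $ i")
    \<comment> \<open>On a degenerate side division by zero gives \<open>u $ i = 0\<close>, which is
      a correct parameter there.\<close>
    case True
    then show ?thesis using x by (auto simp: u_def mem_box_cart intro: antisym dest: spec[of _ i])
  next
    case False
    then have "a $ i < b $ i"
      using assms by (simp add: less_eq_vec_def less_le)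
    then show ?thesis using x by (auto simp: u_def mem_box_cart)
  qed
  then show "x \<in> (\<lambda>u. \<chi> i. a $ i + u $ i * (b $ i - a $ i)) ` cbox 0 1"
    by (intro image_eqI[of _ _ u]) (auto simp: mem_box_cart vec_eq_iff)
next
  fix x assume "x \<in> (\<lambda>u. \<chi> i. a $ i + u $ i * (b $ i - a $ i)) ` cbox 0 1"
  then obtain u where u: "u \<in> cbox 0 1" and x: "x = (\<chi> i. a $ i + u $ i * (b $ i - a $ i))"
    by blast
  show "x \<in> cbox a b"
    unfolding mem_box_cart
  proof
    fix i
    have "0 \<le> u $ i" "u $ i \<le> 1" "0 \<le> b $ i - a $ i"
      using u assms by (auto simp: mem_box_cart less_eq_vec_def)
    then have "0 \<le> u $ i * (b $ i - a $ i)" "u $ i * (b $ i - a $ i) \<le> b $ i - a $ i"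
      by (auto intro: mult_left_le_one_le)
    then show "a $ i \<le> x $ i \<and> x $ i \<le> b $ i"
      by (simp add: x)
  qed
qed

text \<open>Taking logarithms turns the products into sums, to which concavity of \<open>ln\<close>
  applies termwise. The factors are strictly positive because the products are nonzero.\<close>

lemma prod_convex_comb_ge_1:
  fixes f g :: "'i \<Rightarrow> real"
  assumes "finite I" "\<And>i. i \<in> I \<Longrightarrow> 0 \<le> f i" "\<And>i. i \<in> I \<Longrightarrow> 0 \<le> g i"
    and "1 \<le> prod f I" "1 \<le> prod g I" and uv: "0 \<le> u" "0 \<le> v" "u + v = 1"
  shows "1 \<le> (\<Prod>i\<in>I. u * f i + v * g i)"
proof -
  have pos: "0 < f i" "0 < g i" if "i \<in> I" for i
    using assms that by (smt (verit) prod_zero)+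
  have comb: "0 < u * f i + v * g i" if "i \<in> I" for i
    using pos[OF that] uv
    by (smt (verit) mult_nonneg_nonneg mult_pos_pos)
  have "0 \<le> u * ln (prod f I) + v * ln (prod g I)"
    using assms by simp
  also have "\<dots> = (\<Sum>i\<in>I. u * ln (f i) + v * ln (g i))"
    using ln_prod[OF \<open>finite I\<close>, of f] ln_prod[OF \<open>finite I\<close>, of g] pos
    by (simp add: sum.distrib sum_distrib_left order_less_imp_not_eq2)
  also have "\<dots> \<le> (\<Sum>i\<in>I. ln (u * f i + v * g i))"
    using ln_concave pos uv by (intro sum_mono) (auto simp: concave_on_iff)
  also have "\<dots> = ln (\<Prod>i\<in>I. u * f i + v * g i)"
    using ln_prod[OF \<open>finite I\<close>, of "\<lambda>i. u * f i + v * g i"] comb by fastforce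
  finally show ?thesis
    using comb by (simp add: prod_pos)
qed

lemma convex_big_boxes:
  fixes C :: "(real ^ 'd) set"
  assumes "convex C"
  shows "convex (big_boxes C)"
  unfolding convex_def
proof clarify
  fix a b a' b' :: "real ^ 'd" and u v :: real
  assume ab: "(a, b) \<in> big_boxes C" and ab': "(a', b') \<in> big_boxes C"
    and uv: "0 \<le> u" "0 \<le> v" "u + v = 1"
  let ?a = "u *\<^sub>R a + v *\<^sub>R a'" and ?b = "u *\<^sub>R b + v *\<^sub>R b'"
  have le: "a \<le> b" "a' \<le> b'" using ab ab' by (auto simp: big_boxes_def)
  then have LE: "?a \<le> ?b"
    using uv by (auto simp: less_eq_vec_def intro!: add_mono mult_left_mono)
  have "1 \<le> (\<Prod>i\<in>UNIV. u * (b $ i - a $ i) + v * (b' $ i - a' $ i))"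
    using ab ab' uv by (intro prod_convex_comb_ge_1) (auto simp: big_boxes_def less_eq_vec_def)
  also have "\<dots> = (\<Prod>i\<in>UNIV. ?b $ i - ?a $ i)"
    by (intro prod.cong) (auto simp: algebra_simps)
  finally have vol: "1 \<le> (\<Prod>i\<in>UNIV. ?b $ i - ?a $ i)" .
  have "cbox ?a ?b \<subseteq> C"
  proof
    fix x assume "x \<in> cbox ?a ?b"
    then obtain w where w: "w \<in> cbox 0 1" and x: "x = (\<chi> i. ?a $ i + w $ i * (?b $ i - ?a $ i))"
      using cbox_eq_image_unit_cbox[OF LE] by blast
    \<comment> \<open>The point \<open>x\<close> of the combined box is the same convex combination
      of the two points with parameter \<open>w\<close> in the original boxes.\<close>
    have "(\<chi> i. a $ i + w $ i * (b $ i - a $ i)) \<in> C" "(\<chi> i. a' $ i + w $ i * (b' $ i - a' $ i)) \<in> C"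
      using w ab ab' cbox_eq_image_unit_cbox[OF le(1)] cbox_eq_image_unit_cbox[OF le(2)]
      by (auto simp: big_boxes_def)
    then have "u *\<^sub>R (\<chi> i. a $ i + w $ i * (b $ i - a $ i)) + v *\<^sub>R (\<chi> i. a' $ i + w $ i * (b' $ i - a' $ i)) \<in> C"
      using assms uv by (auto simp: convex_def)
    also have "u *\<^sub>R (\<chi> i. a $ i + w $ i * (b $ i - a $ i)) + v *\<^sub>R (\<chi> i. a' $ i + w $ i * (b' $ i - a' $ i)) = x"
      by (simp add: x vec_eq_iff algebra_simps)
    finally show "x \<in> C" .
  qed
  with LE vol show "u *\<^sub>R (a, b) + v *\<^sub>R (a', b') \<in> big_boxes C"
    by (simp add: big_boxes_def)
qed

text \<open>Closed, since containment in \<open>C\<close> is an intersection of preimages of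
  \<open>C\<close> under continuous maps, one for each parameter in the unit cube; bounded, since
  both corners lie in \<open>C\<close>.\<close>

lemma compact_big_boxes:
  fixes C :: "(real ^ 'd) set"
  assumes "compact C"
  shows "compact (big_boxes C)"
proof -
  have "p \<in> big_boxes C \<longleftrightarrow> p \<in> {p. \<forall>i. fst p $ i \<le> snd p $ i}
      \<inter> {p. 1 \<le> (\<Prod>i\<in>UNIV. snd p $ i - fst p $ i)}
      \<inter> (\<Inter>u\<in>cbox 0 1. (\<lambda>p. \<chi> i. fst p $ i + u $ i * (snd p $ i - fst p $ i)) -` C)" for p
  proof (cases "fst p \<le> snd p")
    case True
    then show ?thesis
      by (simp add: big_boxes_def case_prod_beta cbox_eq_image_unit_cbox[OF True] image_subset_iff)
        (simp add: less_eq_vec_def)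
  next
    case False
    then show ?thesis
      by (auto simp: big_boxes_def less_eq_vec_def)
  qed
  then have "big_boxes C = {p. \<forall>i. fst p $ i \<le> snd p $ i}
      \<inter> {p. 1 \<le> (\<Prod>i\<in>UNIV. snd p $ i - fst p $ i)}
      \<inter> (\<Inter>u\<in>cbox 0 1. (\<lambda>p. \<chi> i. fst p $ i + u $ i * (snd p $ i - fst p $ i)) -` C)"
    by blast
  then have "closed (big_boxes C)"
    using compact_imp_closed[OF assms]
    by (simp only:) (intro closed_Int closed_INT closed_Collect_le closed_Collect_all closed_vimage
        continuous_intros ballI)
  moreover have "big_boxes C \<subseteq> C \<times> C"
    by (auto simp: big_boxes_def subset_iff mem_box_cart less_eq_vec_def)
  ultimately show ?thesis
    using compact_Times[OF assms assms] by (meson bounded_subset compact_eq_bounded_closed)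
qed

lemma unit_volume_subbox:
  fixes a b :: "real ^ 'd"
  assumes "a \<le> b" "1 \<le> (\<Prod>i\<in>UNIV. b $ i - a $ i)"
  obtains c where "a \<le> c" "c \<le> b" "measure lebesgue (cbox a c) = 1"
proof -
  obtain k :: 'd where True by blast
  define P where "P = (\<Prod>i\<in>UNIV. b $ i - a $ i)"
  \<comment> \<open>Scaling the single side \<open>k\<close> by \<open>inverse P\<close> divides the
    volume \<open>P\<close> by itself, and \<open>inverse P \<le> 1\<close> keeps the new box inside
    the old one.\<close>
  define c where "c = (\<chi> i. a $ i + (b $ i - a $ i) * (if i = k then inverse P else 1))"
  have P: "0 < inverse P" "inverse P \<le> 1"
    using assms by (auto simp: P_def inverse_le_1_iff)
  have nonneg: "0 \<le> b $ i - a $ i" for i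
    using assms by (simp add: less_eq_vec_def)
  have "a \<le> c" using P nonneg by (auto simp: c_def less_eq_vec_def)
  have "c \<le> b"
    unfolding less_eq_vec_def
  proof
    fix i
    have "(b $ i - a $ i) * (if i = k then inverse P else 1) \<le> (b $ i - a $ i) * 1"
      using P nonneg[of i] by (intro mult_left_mono) auto
    then show "c $ i \<le> b $ i" by (simp add: c_def)
  qed
  have "measure lebesgue (cbox a c) = (\<Prod>i\<in>UNIV. c $ i - a $ i)"
    using \<open>a \<le> c\<close> by (simp add: content_cbox_cart interval_ne_empty_cart less_eq_vec_def)
  also have "\<dots> = P * inverse P"
    by (simp add: c_def prod.distrib P_def)
  also have "\<dots> = 1"
    using P by simp
  finally show thesis
    using that \<open>a \<le> c\<close> \<open>c \<le> b\<close> by blast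
qed

section \<open>The Helly number of boxes of volume one\<close>

text \<open>The coordinate is set to 0 instead of removed, so that the image stays in the same type,
  inside a hyperplane.\<close>

definition forget_coord :: "'d \<Rightarrow> (real ^ 'd) \<times> (real ^ 'd) \<Rightarrow> (real ^ 'd) \<times> (real ^ 'd)" where
  "forget_coord k p = (fst p, \<chi> i. if i = k then 0 else snd p $ i)"

lemma linear_forget_coord: "linear (forget_coord k)"
  by (auto intro!: linearI simp: forget_coord_def vec_eq_iff)

lemma Helly_big_boxes_finite:
  fixes C :: "'i \<Rightarrow> (real ^ 'd) set"
  assumes "finite I" and convex: "\<And>i. i \<in> I \<Longrightarrow> convex (C i)"
    and meet: "\<And>J. J \<subseteq> I \<Longrightarrow> card J \<le> 2 * CARD('d) \<Longrightarrow> (\<Inter>j\<in>J. big_boxes (C j)) \<noteq> {}"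
  shows "(\<Inter>i\<in>I. big_boxes (C i)) \<noteq> {}"
proof (cases "I = {}")
  case False
  obtain k :: 'd where True by blast
  define w :: "(real ^ 'd) \<times> (real ^ 'd)" where "w = (0, axis k 1)"
  define V where "V = {x. w \<bullet> x = 0}"
  have "w \<noteq> 0" by (simp add: w_def zero_prod_def axis_eq_0_iff)
  then have "dim V = DIM((real ^ 'd) \<times> (real ^ 'd)) - 1"
    unfolding V_def by (rule dim_hyperplane)
  then have dimV: "dim V + 1 = 2 * CARD('d)"
    by simp
  have "(\<Inter>i\<in>I. forget_coord k ` big_boxes (C i)) \<noteq> {}"
  proof (rule Helly_subspace)
    show "subspace V"
      unfolding V_def by (rule subspace_hyperplane)
    show "convex (forget_coord k ` big_boxes (C i))" if "i \<in> I" for i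
      by (simp add: convex convex_big_boxes convex_linear_image linear_forget_coord that)
    show "forget_coord k ` big_boxes (C i) \<subseteq> V" for i
      by (auto simp: V_def w_def forget_coord_def inner_axis')
    show "(\<Inter>j\<in>J. forget_coord k ` big_boxes (C j)) \<noteq> {}" if "J \<subseteq> I" "card J \<le> dim V + 1" for J
      using meet[of J] that dimV by fastforce
  qed fact
  then obtain q where "\<forall>i\<in>I. q \<in> forget_coord k ` big_boxes (C i)"
    by blast
  then obtain p where p: "\<And>i. i \<in> I \<Longrightarrow> p i \<in> big_boxes (C i)" "\<And>i. i \<in> I \<Longrightarrow> forget_coord k (p i) = q"
    unfolding image_iff by metis
  \<comment> \<open>The boxes \<open>p i\<close> have the same projection \<open>q\<close>, so they
    differ at most in coordinate \<open>k\<close> of the upper corner. The one where it is smallest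
    is contained in all the others and still has volume at least 1.\<close>
  define m where "m = arg_min_on (\<lambda>i. snd (p i) $ k) I"
  have m: "m \<in> I" "\<And>i. i \<in> I \<Longrightarrow> snd (p m) $ k \<le> snd (p i) $ k"
    unfolding m_def using assms(1) False by (auto intro: arg_min_if_finite arg_min_least)
  have "p m \<in> big_boxes (C i)" if "i \<in> I" for i
  proof -
    have eq: "forget_coord k (p i) = forget_coord k (p m)"
      using p(2) m(1) that by simp
    then have fst: "fst (p i) = fst (p m)"
      by (simp add: forget_coord_def)
    have "snd (p m) $ j \<le> snd (p i) $ j" for j
      using eq m(2)[OF that]
      by (cases "j = k") (auto simp: forget_coord_def vec_eq_iff dest!: spec[of _ j])
    then have "cbox (fst (p m)) (snd (p m)) \<subseteq> cbox (fst (p i)) (snd (p i))"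
      unfolding fst subset_iff mem_box_cart by (meson order_trans)
    then show ?thesis
      using p(1)[OF that] p(1)[OF m(1)] by (force simp: big_boxes_def)
  qed
  then show ?thesis by blast
qed simp

text \<open>The finite intersection property inside the compact set \<open>big_boxes (C i0)\<close>
  reduces this to finite families.\<close>

lemma Helly_big_boxes:
  fixes C :: "'i \<Rightarrow> (real ^ 'd) set"
  assumes "I \<noteq> {}" and convex: "\<And>i. i \<in> I \<Longrightarrow> convex (C i)" and compact: "\<And>i. i \<in> I \<Longrightarrow> compact (C i)"
    and meet: "\<And>J. finite J \<Longrightarrow> J \<subseteq> I \<Longrightarrow> card J \<le> 2 * CARD('d) \<Longrightarrow> (\<Inter>j\<in>J. big_boxes (C j)) \<noteq> {}"
  shows "(\<Inter>i\<in>I. big_boxes (C i)) \<noteq> {}"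
proof -
  obtain i0 where i0: "i0 \<in> I" using \<open>I \<noteq> {}\<close> by blast
  have "big_boxes (C i0) \<inter> (\<Inter>i\<in>I. big_boxes (C i)) \<noteq> {}"
  proof (rule compact_imp_fip_image)
    show "compact (big_boxes (C i0))"
      using i0 compact by (simp add: compact_big_boxes)
    show "closed (big_boxes (C i))" if "i \<in> I" for i
      using that compact by (simp add: compact_big_boxes compact_imp_closed)
    fix J assume J: "finite J" "J \<subseteq> I"
    have "(\<Inter>i\<in>insert i0 J. big_boxes (C i)) \<noteq> {}"
    proof (rule Helly_big_boxes_finite)
      show "(\<Inter>j\<in>J'. big_boxes (C j)) \<noteq> {}" if "J' \<subseteq> insert i0 J" "card J' \<le> 2 * CARD('d)" for J'
        using that J i0 by (intro meet) (auto intro: finite_subset)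
    qed (use J i0 convex in auto)
    then show "big_boxes (C i0) \<inter> (\<Inter>i\<in>J. big_boxes (C i)) \<noteq> {}"
      by simp
  qed
  then show ?thesis by blast
qed

section \<open>Visibility regions\<close>

lemma compact_visibility_region:
  fixes K :: "'a::euclidean_space set"
  assumes "compact K"
  shows "compact {x. sees K x y}"
proof -
  have "{x. sees K x y} = (\<Inter>t\<in>{0..1}. (\<lambda>x. (1 - t) *\<^sub>R x + t *\<^sub>R y) -` K)"
    by (fastforce simp: sees_def subset_iff in_segment)
  moreover have "closed ((\<lambda>x. (1 - t) *\<^sub>R x + t *\<^sub>R y) -` K)" for t
    using compact_imp_closed[OF assms] by (intro closed_vimage continuous_intros)
  ultimately have "closed {x. sees K x y}"
    by (simp add: closed_INT)
  moreover have "{x. sees K x y} \<subseteq> K"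
    by (auto simp: sees_def)
  ultimately show ?thesis
    using assms by (meson bounded_subset compact_eq_bounded_closed)
qed

lemma first_time_at_level:
  fixes f :: "real \<Rightarrow> real"
  assumes "s < e" "continuous_on {s..e} f" "f e < r" "r < f s"
  obtains t where "s < t" "t \<le> e" "f t = r" "\<And>u. s \<le> u \<Longrightarrow> u < t \<Longrightarrow> r < f u"
proof -
  define S where "S = {s..e} \<inter> f -` {..r}"
  have "closed S"
    unfolding S_def using assms by (intro continuous_closed_preimage) auto
  moreover have "e \<in> S" and below: "bdd_below S"
    using assms by (auto simp: S_def)
  ultimately have t: "Inf S \<in> S"
    using closed_contains_Inf by blast
  then have "s \<le> Inf S" "Inf S \<le> e" "f (Inf S) \<le> r" by (auto simp: S_def)
  have least: "Inf S \<le> u" if "u \<in> S" for u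
    using that below by (rule cInf_lower)
  obtain u where u: "s \<le> u" "u \<le> Inf S" "f u = r"
    using IVT2'[of f "Inf S" r s] assms \<open>s \<le> Inf S\<close> \<open>Inf S \<le> e\<close> \<open>f (Inf S) \<le> r\<close>
    by (meson atLeastatMost_subset_iff continuous_on_subset less_imp_le order_refl)
  then have "u \<in> S" using \<open>Inf S \<le> e\<close> by (auto simp: S_def)
  then have "u = Inf S" using least u by force
  show thesis
  proof
    show "f (Inf S) = r" using u \<open>u = Inf S\<close> by simp
    then show "s < Inf S" using \<open>s \<le> Inf S\<close> assms(4) by (cases "s = Inf S") auto
    show "r < f v" if "s \<le> v" "v < Inf S" for v
      using least[of v] that \<open>Inf S \<le> e\<close> by (force simp: S_def)
  qed fact
qed

text \<open>If \<open>x\<close> does not see \<open>y\<close>, some point \<open>p s\<close> of the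
  segment is outside \<open>K\<close>. Moving from it towards \<open>y\<close>, stop when the
  distance to \<open>K\<close> has first halved, at \<open>p t\<close> with nearest point
  \<open>q\<close> in \<open>K\<close>. The hyperplane through \<open>q\<close> orthogonal to
  \<open>p t - q\<close> then strictly separates \<open>x\<close> from all points that see
  \<open>q\<close>.\<close>

lemma sees_all_if_in_visibility_hulls:
  fixes K :: "'a::euclidean_space set"
  assumes "compact K" and hull: "\<And>y. y \<in> K \<Longrightarrow> x \<in> convex hull {z. sees K z y}" and "y \<in> K"
  shows "sees K x y"
proof (rule ccontr)
  assume "\<not> sees K x y"
  define p where "p t = (1 - t) *\<^sub>R x + t *\<^sub>R y" for t :: real
  define f where "f t = infdist (p t) K" for t
  from \<open>\<not> sees K x y\<close> obtain s where s: "0 \<le> s" "s \<le> 1" "p s \<notin> K"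
    by (auto simp: sees_def closed_segment_def p_def)
  have cl: "closed K" "K \<noteq> {}" using assms by (auto simp: compact_imp_closed)
  have "0 < f s"
    using s cl by (metis f_def in_closed_iff_infdist_zero infdist_nonneg less_le)
  have "p 1 = y" by (simp add: p_def)
  then have "f 1 = 0" and "s \<noteq> 1" using \<open>y \<in> K\<close> s by (auto simp: f_def)
  have "continuous_on {s..1} f"
    unfolding f_def p_def by (intro continuous_intros)
  then obtain t where t: "s < t" "t \<le> 1" "f t = f s / 2" "\<And>u. s \<le> u \<Longrightarrow> u < t \<Longrightarrow> f s / 2 < f u"
    using first_time_at_level[of s 1 f "f s / 2"] s \<open>0 < f s\<close> \<open>f 1 = 0\<close> \<open>s \<noteq> 1\<close> by auto
  obtain q where q: "q \<in> K" "f t = dist (p t) q"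
    unfolding f_def using infdist_attains_inf[OF cl] by blast
  have "p t \<noteq> q" using q t \<open>0 < f s\<close> by auto
  \<comment> \<open>Between \<open>s\<close> and \<open>t\<close> the distance to \<open>K\<close>
    is at least \<open>f t\<close>, so \<open>p t\<close> is the point of the segment from
    \<open>p t\<close> to \<open>p s\<close> closest to \<open>q\<close>.\<close>
  have toward: "(q - p t) \<bullet> (p s - p t) \<le> 0"
  proof (rule any_closest_point_dot)
    show "\<forall>z\<in>closed_segment (p t) (p s). dist q (p t) \<le> dist q z"
    proof
      fix z assume "z \<in> closed_segment (p t) (p s)"
      then obtain l where l: "0 \<le> l" "l \<le> 1" "z = (1 - l) *\<^sub>R p t + l *\<^sub>R p s"
        by (auto simp: closed_segment_def)
      define u where "u = (1 - l) * t + l * s"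
      have z: "z = p u"
        by (simp add: l p_def u_def algebra_simps)
      have "u = t - l * (t - s)" "u = s + (1 - l) * (t - s)" by (auto simp: u_def algebra_simps)
      moreover have "0 \<le> l * (t - s)" "0 \<le> (1 - l) * (t - s)" using l t by auto
      ultimately have "s \<le> u" "u \<le> t" by linarith+
      then have "f t \<le> f u" using t(3) t(4)[of u] by (cases "u = t") auto
      also have "f u \<le> dist z q" using q z by (simp add: f_def infdist_le)
      finally show "dist q (p t) \<le> dist q z" using q by (simp add: dist_commute)
    qed
  qed auto
  \<comment> \<open>From \<open>p t\<close>, the points \<open>x\<close> and \<open>p s\<close> lie
    in the same direction, so the inequality carries over to \<open>x\<close>.\<close>
  have "x - p t = (t / (t - s)) *\<^sub>R (p s - p t)"
  proof -
    have "p s - p t = (t - s) *\<^sub>R (x - y)" "x - p t = t *\<^sub>R (x - y)"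
      by (auto simp: p_def algebra_simps)
    then show ?thesis using t by simp
  qed
  then have "(q - p t) \<bullet> (x - p t) = (t / (t - s)) * ((q - p t) \<bullet> (p s - p t))"
    by simp
  also have "\<dots> \<le> 0"
    using toward t s by (intro mult_nonneg_nonpos) auto
  finally have x: "(q - p t) \<bullet> (x - p t) \<le> 0" .
  \<comment> \<open>If \<open>z\<close> sees \<open>q\<close>, the segment from \<open>z\<close> to
    \<open>q\<close> lies in \<open>K\<close>, so \<open>q\<close> is its point nearest to
    \<open>p t\<close>.\<close>
  have "{z. sees K z q} \<subseteq> {z. (p t - q) \<bullet> z \<le> (p t - q) \<bullet> q}"
  proof clarify
    fix z assume "sees K z q"
    have "(p t - q) \<bullet> (z - q) \<le> 0"
    proof (rule any_closest_point_dot)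
      show "\<forall>w\<in>closed_segment z q. dist (p t) q \<le> dist (p t) w"
        using \<open>sees K z q\<close> q(2) infdist_le[of _ K "p t"] by (auto simp: sees_def f_def)
    qed auto
    then show "(p t - q) \<bullet> z \<le> (p t - q) \<bullet> q"
      by (simp add: inner_diff_right)
  qed
  then have "convex hull {z. sees K z q} \<subseteq> {z. (p t - q) \<bullet> z \<le> (p t - q) \<bullet> q}"
    by (intro hull_minimal convex_halfspace_le)
  then have "(p t - q) \<bullet> x \<le> (p t - q) \<bullet> q"
    using hull[OF q(1)] by blast
  moreover have "(p t - q) \<bullet> (p t - q) > 0"
    using \<open>p t \<noteq> q\<close> by simp
  ultimately show False
    using x by (simp add: inner_diff_right inner_diff_left inner_commute)
qed

theorem theorem3p4:
  fixes K :: "(real ^ 'd) set"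
  assumes "compact K"
    and "\<And>p :: nat \<Rightarrow> real ^ 'd. (\<forall>i < 2 * CARD('d). p i \<in> K) \<Longrightarrow>
           \<exists>B. axis_parallel_box B \<and> measure lebesgue B = 1 \<and>
             (\<forall>x \<in> B. \<forall>i < 2 * CARD('d). sees K x (p i))"
  shows "\<exists>B. axis_parallel_box B \<and> measure lebesgue B = 1 \<and>
           (\<forall>x \<in> B. \<forall>y \<in> K. sees K x y)"
proof (cases "K = {}")
  case True
  have "measure lebesgue (cbox 0 1 :: (real ^ 'd) set) = 1"
    by (simp add: content_cbox_cart interval_ne_empty_cart)
  moreover have "axis_parallel_box (cbox 0 1 :: (real ^ 'd) set)"
    unfolding axis_parallel_box_def by (intro exI[of _ 0] exI[of _ 1]) (simp add: less_eq_vec_def)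
  ultimately show ?thesis
    using True by blast
next
  case False
  then obtain y0 where "y0 \<in> K" by blast
  define C where "C y = convex hull {x. sees K x y}" for y
  have "(\<Inter>y\<in>K. big_boxes (C y)) \<noteq> {}"
  proof (rule Helly_big_boxes)
    show "convex (C y)" "compact (C y)" for y
      unfolding C_def using assms(1) by (auto intro: compact_convex_hull compact_visibility_region)
    fix J assume J: "finite J" "J \<subseteq> K" "card J \<le> 2 * CARD('d)"
    then obtain h where h: "J = h ` {..<card J}"
      by (metis atLeast0LessThan bij_betw_def ex_bij_betw_nat_finite)
    \<comment> \<open>The hypothesis takes exactly \<open>2 * CARD('d)\<close> points, so a smaller
      \<open>J\<close> is padded with copies of \<open>y0\<close>.\<close>
    define p where "p i = (if i < card J then h i else y0)" for i
    have "\<forall>i < 2 * CARD('d). p i \<in> K"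
      using h J \<open>y0 \<in> K\<close> by (auto simp: p_def)
    then obtain B where "axis_parallel_box B" and B: "measure lebesgue B = 1"
      "\<forall>x \<in> B. \<forall>i < 2 * CARD('d). sees K x (p i)"
      using assms(2) by blast
    then obtain a b where ab: "a \<le> b" "B = cbox a b"
      by (auto simp: axis_parallel_box_def)
    have "(\<Prod>i\<in>UNIV. b $ i - a $ i) = 1"
      using B(1) ab by (simp add: content_cbox_cart interval_ne_empty_cart less_eq_vec_def)
    moreover have "cbox a b \<subseteq> C y" if "y \<in> J" for y
    proof -
      have "y \<in> h ` {..<card J}"
        using h that by (rule subst)
      then obtain i where "i < card J" "y = p i"
        by (auto simp: p_def)
      moreover from this have "i < 2 * CARD('d)"
        using J(3) by linarith
      ultimately have "cbox a b \<subseteq> {x. sees K x y}"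
        using B(2) ab(2) by blast
      then show ?thesis
        unfolding C_def by (rule order_trans[OF _ hull_subset])
    qed
    ultimately have "(a, b) \<in> (\<Inter>j\<in>J. big_boxes (C j))"
      using ab by (simp add: big_boxes_def)
    then show "(\<Inter>j\<in>J. big_boxes (C j)) \<noteq> {}" by blast
  qed fact
  then obtain a b where ab: "\<And>y. y \<in> K \<Longrightarrow> (a, b) \<in> big_boxes (C y)"
    by auto
  then have "a \<le> b" "1 \<le> (\<Prod>i\<in>UNIV. b $ i - a $ i)"
    using \<open>y0 \<in> K\<close> by (auto simp: big_boxes_def)
  then obtain c where c: "a \<le> c" "c \<le> b" "measure lebesgue (cbox a c) = 1"
    by (rule unit_volume_subbox)
  have "cbox a c \<subseteq> cbox a b"
    using c(2) unfolding subset_iff mem_box_cart less_eq_vec_def by (meson order_trans)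
  moreover have "cbox a b \<subseteq> C y" if "y \<in> K" for y
    using ab[OF that] by (simp add: big_boxes_def)
  ultimately have "x \<in> C y" if "x \<in> cbox a c" "y \<in> K" for x y
    using that by blast
  then have "sees K x y" if "x \<in> cbox a c" "y \<in> K" for x y
    using sees_all_if_in_visibility_hulls[OF assms(1) _ that(2)] that(1) unfolding C_def by blast
  then show ?thesis
    using c(1,3) unfolding axis_parallel_box_def by blast
qed

end
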